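(* Let $n,m\in\mathbb{N}$, let $S_1,S_2\in\mathbb{V}(X)$ be sets with $S_1$ completely coherent, let $\mathcal{U}\in\beta S_1$, $\mathcal{V}\in\beta S_2$, and let $\alpha\in\mu_n(\mathcal{U})$, $\beta\in\mu_m(\mathcal{V})$. Then $(\alpha,S_n(\beta))\in\mu_{n+m}(\mathcal{U}\otimes\mathcal{V})$.
   Context: Work in a single superstructure model $\langle\mathbb{V}(X),\mathbb{V}(X),\ast\rangle$ of nonstandard methods ($X$ infinite, $\ast$ a star map on $\mathbb{V}(X)$ satisfying transfer). Define $S_0=\mathrm{id}$, $S_{n+1}=\ast\circ S_n$. For an ultrafilter $\mathcal{W}$ on a set $Y$, $\mu_k(\mathcal{W})=\bigcap_{A\in\mathcal{W}}S_k(A)$. A set $Y$ is completely coherent if $A\subseteq{}^{\ast}A$ for every $A\subseteq Y$. The tensor product $\mathcal{U}\otimes\mathcal{V}$ is the ultrafilter on $S_1\times S_2$ with $A\in\mathcal{U}\otimes\mathcal{V}$ iff $\{s_1\in S_1\mid\{s_2\in S_2\mid (s_1,s_2)\in A\}\in\mathcal{V}\}\in\mathcal{U}$. *)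

theory Defs
  imports Main
begin

(* No HOL type can be constructed that provably contains a superstructure over an infinite
   set, so V(X) is given by a type with a membership relation E and a set X of atoms; the
   locale "superstructure" below determines (V(X), E) up to isomorphism over X. *)

definition ext :: "('v \<Rightarrow> 'v \<Rightarrow> bool) \<Rightarrow> 'v \<Rightarrow> 'v set" where
  "ext E a = {x. E x a}"

fun level :: "('v \<Rightarrow> 'v \<Rightarrow> bool) \<Rightarrow> 'v set \<Rightarrow> nat \<Rightarrow> 'v set" where
  "level E X 0 = X"
| "level E X (Suc n) = level E X n \<union> {a. a \<notin> X \<and> ext E a \<subseteq> level E X n}"

definition VV :: "('v \<Rightarrow> 'v \<Rightarrow> bool) \<Rightarrow> 'v set \<Rightarrow> 'v set" where
  "VV E X = (\<Union>n. level E X n)"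

locale superstructure =
  fixes E :: "'v \<Rightarrow> 'v \<Rightarrow> bool" and X :: "'v set"
  assumes atoms: "x \<in> X \<Longrightarrow> ext E x = {}"
    and extensional: "inj_on (ext E) (VV E X - X)"
    and powerset: "A \<subseteq> level E X n \<Longrightarrow> \<exists>a. a \<notin> X \<and> ext E a = A"

(* The element of V(X) representing a subset of some level; unspecified for other A. *)
definition code :: "('v \<Rightarrow> 'v \<Rightarrow> bool) \<Rightarrow> 'v set \<Rightarrow> 'v set \<Rightarrow> 'v" where
  "code E X A = (THE a. a \<in> VV E X - X \<and> ext E a = A)"

definition pair :: "('v \<Rightarrow> 'v \<Rightarrow> bool) \<Rightarrow> 'v set \<Rightarrow> 'v \<Rightarrow> 'v \<Rightarrow> 'v" where
  "pair E X a b = code E X {code E X {a}, code E X {a, b}}"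

(* Bounded formulas of the language with membership and equality.  Parameters from V(X)
   are supplied by the assignment; BAll i j p is the quantifier "for all v_i in v_j". *)
datatype bfm = Mem nat nat | Eq nat nat | Neg bfm | Conj bfm bfm | BAll nat nat bfm

primrec sat :: "('v \<Rightarrow> 'v \<Rightarrow> bool) \<Rightarrow> (nat \<Rightarrow> 'v) \<Rightarrow> bfm \<Rightarrow> bool" where
  "sat E e (Mem i j) \<longleftrightarrow> E (e i) (e j)"
| "sat E e (Eq i j) \<longleftrightarrow> e i = e j"
| "sat E e (Neg p) \<longleftrightarrow> \<not> sat E e p"
| "sat E e (Conj p q) \<longleftrightarrow> sat E e p \<and> sat E e q"
| "sat E e (BAll i j p) \<longleftrightarrow> (\<forall>a \<in> ext E (e j). sat E (e(i := a)) p)"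

locale single_superstructure_model = superstructure E X
  for E :: "'v \<Rightarrow> 'v \<Rightarrow> bool" and X :: "'v set" +
  fixes star :: "'v \<Rightarrow> 'v"
  assumes infinite_atoms: "infinite X"
    and star_closed: "a \<in> VV E X \<Longrightarrow> star a \<in> VV E X"
    and transfer: "range e \<subseteq> VV E X \<Longrightarrow> sat E e p \<longleftrightarrow> sat E (star \<circ> e) p"

definition completely_coherent ::
    "('v \<Rightarrow> 'v \<Rightarrow> bool) \<Rightarrow> 'v set \<Rightarrow> ('v \<Rightarrow> 'v) \<Rightarrow> 'v \<Rightarrow> bool" where
  "completely_coherent E X star Y \<longleftrightarrow>
     (\<forall>A. A \<subseteq> ext E Y \<longrightarrow> A \<subseteq> ext E (star (code E X A)))"

definition ultrafilter_on :: "'a set \<Rightarrow> 'a set set \<Rightarrow> bool" where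
  "ultrafilter_on Y W \<longleftrightarrow>
     W \<subseteq> Pow Y \<and> Y \<in> W \<and> {} \<notin> W \<and>
     (\<forall>A\<in>W. \<forall>B\<in>W. A \<inter> B \<in> W) \<and>
     (\<forall>A\<in>W. \<forall>B. A \<subseteq> B \<longrightarrow> B \<subseteq> Y \<longrightarrow> B \<in> W) \<and>
     (\<forall>A. A \<subseteq> Y \<longrightarrow> A \<in> W \<or> Y - A \<in> W)"

definition mu ::
    "('v \<Rightarrow> 'v \<Rightarrow> bool) \<Rightarrow> 'v set \<Rightarrow> ('v \<Rightarrow> 'v) \<Rightarrow> nat \<Rightarrow> 'v set set \<Rightarrow> 'v set" where
  "mu E X star k W = (\<Inter>A\<in>W. ext E ((star ^^ k) (code E X A)))"

definition cart :: "('v \<Rightarrow> 'v \<Rightarrow> bool) \<Rightarrow> 'v set \<Rightarrow> 'v \<Rightarrow> 'v \<Rightarrow> 'v set" where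
  "cart E X S T = {pair E X s t | s t. s \<in> ext E S \<and> t \<in> ext E T}"

definition tensor :: "('v \<Rightarrow> 'v \<Rightarrow> bool) \<Rightarrow> 'v set \<Rightarrow> 'v \<Rightarrow> 'v
    \<Rightarrow> 'v set set \<Rightarrow> 'v set set \<Rightarrow> 'v set set" where
  "tensor E X S T U V =
     {A. A \<subseteq> cart E X S T \<and>
         {s \<in> ext E S. {t \<in> ext E T. pair E X s t \<in> A} \<in> V} \<in> U}"

context superstructure
begin

lemma level_mono: "m \<le> n \<Longrightarrow> level E X m \<subseteq> level E X n"
  by (induction rule: dec_induct) auto

lemma ext_subset_level:
  assumes "a \<in> VV E X"
  shows "\<exists>n. ext E a \<subseteq> level E X n"
proof -
  have "a \<in> level E X n \<Longrightarrow> ext E a \<subseteq> level E X n" for n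
    by (induction n) (auto simp: atoms)
  then show ?thesis using assms by (auto simp: VV_def)
qed

lemma VV_transitive: "a \<in> VV E X \<Longrightarrow> x \<in> ext E a \<Longrightarrow> x \<in> VV E X"
  using ext_subset_level by (fastforce simp: VV_def)

lemma code_ext:
  assumes "a \<in> VV E X - X"
  shows "code E X (ext E a) = a"
  unfolding code_def
proof (rule the_equality)
  fix b assume "b \<in> VV E X - X \<and> ext E b = ext E a"
  then show "b = a" using inj_onD[OF extensional _ _ assms] by blast
qed (use assms in simp)

lemma code_props:
  assumes "A \<subseteq> level E X n"
  shows "code E X A \<in> level E X (Suc n)" "code E X A \<notin> X" "ext E (code E X A) = A"
proof -
  obtain a where a: "a \<notin> X" "ext E a = A" using powerset[OF assms] by blast
  have l: "a \<in> level E X (Suc n)" using a assms by simp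
  then have "a \<in> VV E X - X" unfolding VV_def using a by blast
  then have "code E X A = a" using code_ext a(2) by blast
  then show "code E X A \<in> level E X (Suc n)" "code E X A \<notin> X" "ext E (code E X A) = A"
    using a l by simp_all
qed

lemma code_subset:
  assumes "a \<in> VV E X" "A \<subseteq> ext E a"
  shows "code E X A \<in> VV E X - X" "ext E (code E X A) = A"
proof -
  obtain n where "A \<subseteq> level E X n" using ext_subset_level assms by blast
  from code_props[OF this] show "code E X A \<in> VV E X - X" "ext E (code E X A) = A"
    unfolding VV_def by blast+
qed

lemma two_in_level:
  assumes "a \<in> VV E X" "b \<in> VV E X"
  shows "\<exists>n. {a, b} \<subseteq> level E X n"
proof -
  obtain i j where "a \<in> level E X i" "b \<in> level E X j" using assms by (auto simp: VV_def)
  then have "{a, b} \<subseteq> level E X (max i j)"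
    using level_mono[of i "max i j"] level_mono[of j "max i j"] by auto
  then show ?thesis by blast
qed

lemma code_two:
  assumes "a \<in> VV E X" "b \<in> VV E X"
  shows "code E X {a, b} \<in> VV E X - X" "ext E (code E X {a, b}) = {a, b}"
proof -
  obtain n where "{a, b} \<subseteq> level E X n" using two_in_level assms by blast
  from code_props[OF this] show "code E X {a, b} \<in> VV E X - X"
      "ext E (code E X {a, b}) = {a, b}"
    unfolding VV_def by blast+
qed

lemma code_one:
  assumes "a \<in> VV E X"
  shows "code E X {a} \<in> VV E X - X" "ext E (code E X {a}) = {a}"
  using code_two[OF assms assms] by simp_all

lemma pair_VV:
  assumes "a \<in> VV E X" "b \<in> VV E X"
  shows "pair E X a b \<in> VV E X - X"
    and "ext E (pair E X a b) = {code E X {a}, code E X {a, b}}"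
  unfolding pair_def using code_two[of "code E X {a}" "code E X {a, b}"]
    code_one(1)[OF assms(1)] code_two(1)[OF assms] by auto

lemma pair_inject:
  assumes "a \<in> VV E X" "b \<in> VV E X" "c \<in> VV E X" "d \<in> VV E X"
  shows "pair E X a b = pair E X c d \<longleftrightarrow> a = c \<and> b = d"
proof
  assume "pair E X a b = pair E X c d"
  then have "ext E ` ext E (pair E X a b) = ext E ` ext E (pair E X c d)" by simp
  then have "{{a}, {a, b}} = {{c}, {c, d}}"
    by (simp add: pair_VV assms code_one code_two)
  then show "a = c \<and> b = d" by (auto simp: doubleton_eq_iff)
qed simp

lemma cart_VV:
  assumes "S \<in> VV E X" "T \<in> VV E X"
  shows "code E X (cart E X S T) \<in> VV E X - X"
    and "ext E (code E X (cart E X S T)) = cart E X S T"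
proof -
  obtain i j where ij: "ext E S \<subseteq> level E X i" "ext E T \<subseteq> level E X j"
    using ext_subset_level[OF assms(1)] ext_subset_level[OF assms(2)] by blast
  define n where "n = max i j"
  have ST: "ext E S \<subseteq> level E X n" "ext E T \<subseteq> level E X n"
    using ij level_mono[of i n] level_mono[of j n] by (auto simp: n_def)
  have "pair E X s t \<in> level E X (Suc (Suc n))" if "s \<in> ext E S" "t \<in> ext E T" for s t
  proof -
    have "code E X {s} \<in> level E X (Suc n)" "code E X {s, t} \<in> level E X (Suc n)"
      by (rule code_props(1), use ST that in blast)+
    then have "{code E X {s}, code E X {s, t}} \<subseteq> level E X (Suc n)" by blast
    then show ?thesis unfolding pair_def by (rule code_props(1))
  qed
  then have "cart E X S T \<subseteq> level E X (Suc (Suc n))" unfolding cart_def by blast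
  note c = code_props[OF this]
  show "code E X (cart E X S T) \<in> VV E X - X"
    using c(1,2) unfolding VV_def by blast
  show "ext E (code E X (cart E X S T)) = cart E X S T"
    by (fact c(3))
qed

lemma tensor_ultrafilter:
  assumes "S \<in> VV E X" "T \<in> VV E X"
    and U: "ultrafilter_on (ext E S) U" and V: "ultrafilter_on (ext E T) V"
  shows "ultrafilter_on (cart E X S T) (tensor E X S T U V)"
proof -
  define sec where "sec A s = {t \<in> ext E T. pair E X s t \<in> A}" for A s
  define big where "big A = {s \<in> ext E S. sec A s \<in> V}" for A
  have ten: "A \<in> tensor E X S T U V \<longleftrightarrow> A \<subseteq> cart E X S T \<and> big A \<in> U" for A
    by (simp add: tensor_def big_def sec_def)
  have U1: "ext E S \<in> U" "{} \<notin> U" "\<And>A B. A \<in> U \<Longrightarrow> B \<in> U \<Longrightarrow> A \<inter> B \<in> U"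
      "\<And>A B. A \<in> U \<Longrightarrow> A \<subseteq> B \<Longrightarrow> B \<subseteq> ext E S \<Longrightarrow> B \<in> U"
      "\<And>A. A \<subseteq> ext E S \<Longrightarrow> A \<in> U \<or> ext E S - A \<in> U"
    using U unfolding ultrafilter_on_def by blast+
  have V1: "ext E T \<in> V" "{} \<notin> V" "\<And>A B. A \<in> V \<Longrightarrow> B \<in> V \<Longrightarrow> A \<inter> B \<in> V"
      "\<And>A B. A \<in> V \<Longrightarrow> A \<subseteq> B \<Longrightarrow> B \<subseteq> ext E T \<Longrightarrow> B \<in> V"
      "\<And>A. A \<subseteq> ext E T \<Longrightarrow> A \<in> V \<or> ext E T - A \<in> V"
    using V unfolding ultrafilter_on_def by blast+
  have bigS: "big A \<subseteq> ext E S" for A by (auto simp: big_def)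
  have secT: "sec A s \<subseteq> ext E T" for A s by (auto simp: sec_def)
  have "sec (cart E X S T) s = ext E T" if "s \<in> ext E S" for s
    using that by (auto simp: sec_def cart_def)
  then have "big (cart E X S T) = ext E S" using V1(1) by (auto simp: big_def)
  then have 1: "cart E X S T \<in> tensor E X S T U V" using U1(1) by (simp add: ten)
  have "big {} = {}" using V1(2) by (auto simp: big_def sec_def)
  then have 2: "{} \<notin> tensor E X S T U V" using U1(2) by (simp add: ten)
  have mono: "big A \<subseteq> big B" if "A \<subseteq> B" for A B
  proof -
    have "sec A s \<subseteq> sec B s" for s using that by (auto simp: sec_def)
    then show ?thesis using V1(4) secT by (auto simp: big_def)
  qed
  have 3: "A \<inter> B \<in> tensor E X S T U V"
    if "A \<in> tensor E X S T U V" "B \<in> tensor E X S T U V" for A B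
  proof -
    have "sec (A \<inter> B) s = sec A s \<inter> sec B s" for s by (auto simp: sec_def)
    then have "big A \<inter> big B \<subseteq> big (A \<inter> B)" using V1(3) by (auto simp: big_def)
    moreover have "big A \<inter> big B \<in> U" using that U1(3) by (simp add: ten)
    ultimately have "big (A \<inter> B) \<in> U" using U1(4) bigS by blast
    then show ?thesis using that by (auto simp: ten)
  qed
  have 4: "A \<in> tensor E X S T U V \<or> cart E X S T - A \<in> tensor E X S T U V"
    if A: "A \<subseteq> cart E X S T" for A
  proof -
    have "sec (cart E X S T - A) s = ext E T - sec A s" if "s \<in> ext E S" for s
      using that by (auto simp: sec_def cart_def)
    then have sub: "ext E S - big A \<subseteq> big (cart E X S T - A)"
      unfolding big_def using V1(5)[OF secT[of A]] by force
    show ?thesis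
    proof (cases "big A \<in> U")
      case False
      then have "ext E S - big A \<in> U" using U1(5)[OF bigS] by blast
      then have "big (cart E X S T - A) \<in> U" using U1(4) sub bigS by blast
      then show ?thesis by (simp add: ten)
    qed (simp add: ten A)
  qed
  have 5: "B \<in> tensor E X S T U V"
    if "A \<in> tensor E X S T U V" "A \<subseteq> B" "B \<subseteq> cart E X S T" for A B
    using that(1,3) U1(4)[OF _ mono[OF that(2)] bigS] by (simp add: ten)
  have 6: "tensor E X S T U V \<subseteq> Pow (cart E X S T)" by (auto simp: ten)
  show ?thesis unfolding ultrafilter_on_def
    by (intro conjI ballI allI impI) (fact 6, fact 1, fact 2, rule 3, assumption+, rule 5,
      assumption+, rule 4, assumption)
qed

end

end

theory Submission
  imports Defs
begin

text \<open>
  Complete coherence applied to singletons forces every element of \<open>S\<^sub>1\<close> to be fixed by the star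
  map. Hence, if \<open>B\<close> is the set of those \<open>s\<close> whose section \<open>A\<^sub>s\<close> lies in \<open>V\<close>, transferring the
  inclusion of \<open>{s} \<times> A\<^sub>s\<close> in \<open>A\<close> along \<open>S\<^sub>m\<close> gives \<open>(s, \<beta>) \<in> S\<^sub>m(A)\<close> for all \<open>s \<in> B\<close>.
  Transferring this statement along \<open>S\<^sub>n\<close>, with \<open>\<beta>\<close> and \<open>S\<^sub>m(A)\<close> as parameters, yields the claim.
\<close>

definition BEx :: "nat \<Rightarrow> nat \<Rightarrow> bfm \<Rightarrow> bfm" where
  "BEx i j p = Neg (BAll i j (Neg p))"

definition Disj :: "bfm \<Rightarrow> bfm \<Rightarrow> bfm" where
  "Disj p q = Neg (Conj (Neg p) (Neg q))"

lemma sat_BEx [simp]: "sat E e (BEx i j p) \<longleftrightarrow> (\<exists>a \<in> ext E (e j). sat E (e(i := a)) p)"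
  by (simp add: BEx_def)

lemma sat_Disj [simp]: "sat E e (Disj p q) \<longleftrightarrow> sat E e p \<or> sat E e q"
  by (simp add: Disj_def)

text \<open>The pair of \<open>v\<^sub>0\<close> and \<open>v\<^sub>1\<close> is an element of \<open>v\<^sub>2\<close>.\<close>

definition PairMem :: bfm where
  "PairMem =
     BEx 3 2 (BEx 4 3 (BEx 5 3 (Conj
       (BAll 6 3 (Disj (Eq 6 4) (Eq 6 5)))
       (Conj (Conj (Mem 0 4) (BAll 6 4 (Eq 6 0)))
         (Conj (Conj (Mem 0 5) (Mem 1 5)) (BAll 6 5 (Disj (Eq 6 0) (Eq 6 1))))))))"

context superstructure
begin

text \<open>Nonemptiness is essential: atoms have the same extension as the empty set.\<close>

lemma eq_code_if_ext_eq:
  assumes "a \<in> VV E X" "ext E a = A" "A \<noteq> {}"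
  shows "a = code E X A"
proof -
  have "a \<in> VV E X - X" using assms atoms by blast
  then show ?thesis using code_ext assms(2) by metis
qed

text \<open>Slots 3, 4 and 5 hold the Kuratowski pair, its singleton and its doubleton; the last two
  may coincide. Since V(X) is transitive, all three witnesses lie in it, and their nonempty
  extensions determine them as values of \<open>code\<close>.\<close>

lemma sat_PairMem:
  assumes "e 0 \<in> VV E X" "e 1 \<in> VV E X" "e 2 \<in> VV E X"
  shows "sat E e PairMem \<longleftrightarrow> pair E X (e 0) (e 1) \<in> ext E (e 2)"
proof -
  have singleton: "C = {a} \<longleftrightarrow> a \<in> C \<and> (\<forall>w \<in> C. w = a)" for a :: 'v and C
    by auto
  have doubleton: "C = {a, b} \<longleftrightarrow> a \<in> C \<and> b \<in> C \<and> (\<forall>w \<in> C. w = a \<or> w = b)" for a b :: 'v and C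
    by auto
  have "sat E e PairMem \<longleftrightarrow>
    (\<exists>z \<in> ext E (e 2). \<exists>u \<in> ext E z. \<exists>v \<in> ext E z. (\<forall>w \<in> ext E z. w = u \<or> w = v)
      \<and> (e 0 \<in> ext E u \<and> (\<forall>w \<in> ext E u. w = e 0))
      \<and> (e 0 \<in> ext E v \<and> e 1 \<in> ext E v) \<and> (\<forall>w \<in> ext E v. w = e 0 \<or> w = e 1))"
    by (simp add: PairMem_def ext_def)
  also have "\<dots> \<longleftrightarrow> (\<exists>z \<in> ext E (e 2). \<exists>u v. ext E z = {u, v} \<and> ext E u = {e 0}
      \<and> ext E v = {e 0, e 1})"
    unfolding singleton doubleton by blast
  also have "\<dots> \<longleftrightarrow> pair E X (e 0) (e 1) \<in> ext E (e 2)"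
  proof
    assume "\<exists>z \<in> ext E (e 2). \<exists>u v. ext E z = {u, v} \<and> ext E u = {e 0} \<and> ext E v = {e 0, e 1}"
    then obtain z u v where z: "z \<in> ext E (e 2)"
      and exts: "ext E z = {u, v}" "ext E u = {e 0}" "ext E v = {e 0, e 1}"
      by blast
    have VV: "z \<in> VV E X" using VV_transitive assms(3) z by blast
    then have "u \<in> VV E X" "v \<in> VV E X" using VV_transitive exts(1) by blast+
    then have "u = code E X {e 0}" "v = code E X {e 0, e 1}"
      using eq_code_if_ext_eq exts(2,3) by simp_all
    then have "z = pair E X (e 0) (e 1)"
      unfolding pair_def using eq_code_if_ext_eq[OF VV exts(1)] by simp
    then show "pair E X (e 0) (e 1) \<in> ext E (e 2)" using z by simp
  next
    assume "pair E X (e 0) (e 1) \<in> ext E (e 2)"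
    then show "\<exists>z \<in> ext E (e 2). \<exists>u v. ext E z = {u, v} \<and> ext E u = {e 0} \<and> ext E v = {e 0, e 1}"
      using pair_VV(2)[OF assms(1,2)] code_one(2)[OF assms(1)] code_two(2)[OF assms(1,2)]
      by (intro bexI exI conjI)
  qed
  finally show ?thesis .
qed

end

context single_superstructure_model
begin

lemma funpow_star_closed: "a \<in> VV E X \<Longrightarrow> (star ^^ k) a \<in> VV E X"
  by (induction k) (auto simp: star_closed)

lemma funpow_transfer:
  assumes "range e \<subseteq> VV E X"
  shows "sat E e p \<longleftrightarrow> sat E ((star ^^ k) \<circ> e) p"
proof (induction k)
  case (Suc k)
  have "range ((star ^^ k) \<circ> e) \<subseteq> VV E X" using assms funpow_star_closed by fastforce
  from transfer[OF this] Suc show ?case by (simp only: funpow.simps comp_assoc)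
qed simp

text \<open>Transfer of "every element of {s} equals s" leaves \<open>star s\<close> as the only
  possible element of the star of {s}. Coherence for the subset {s} puts \<open>s\<close>
  there.\<close>

lemma coherent_imp_fixed:
  assumes "completely_coherent E X star Y" "Y \<in> VV E X" "s \<in> ext E Y"
  shows "star s = s"
proof -
  let ?c = "code E X {s}"
  let ?e = "\<lambda>i::nat. if i = 0 then ?c else s"
  have s: "s \<in> VV E X" using VV_transitive assms by blast
  then have "range ?e \<subseteq> VV E X" using code_one by auto
  moreover have "sat E ?e (BAll 2 0 (Eq 2 1))" using code_one(2)[OF s] by simp
  ultimately have "sat E (star \<circ> ?e) (BAll 2 0 (Eq 2 1))" using transfer by blast
  then have "\<forall>x \<in> ext E (star ?c). x = star s" by simp
  moreover have "s \<in> ext E (star ?c)"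
    using assms unfolding completely_coherent_def by blast
  ultimately show ?thesis by simp
qed

lemma transfer_pair_left:
  assumes "B \<in> VV E X" "c \<in> VV E X" "A \<in> VV E X"
    and "\<And>s. s \<in> ext E B \<Longrightarrow> pair E X s c \<in> ext E A"
    and "s \<in> ext E ((star ^^ k) B)"
  shows "pair E X s ((star ^^ k) c) \<in> ext E ((star ^^ k) A)"
proof -
  \<comment> \<open>Slot 7 carries \<open>B\<close>, being the first index that
    \<open>PairMem\<close> does not touch. With \<open>B\<close> as default value, the whole range
    stays in V(X).\<close>
  let ?e = "\<lambda>i::nat. if i = 1 then c else if i = 2 then A else B"
  have "range ?e \<subseteq> VV E X" using assms by auto
  moreover have "sat E ?e (BAll 0 7 PairMem)"
    using assms VV_transitive by (simp add: sat_PairMem)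
  ultimately have "sat E ((star ^^ k) \<circ> ?e) (BAll 0 7 PairMem)" using funpow_transfer by blast
  then have "sat E (((star ^^ k) \<circ> ?e)(0 := s)) PairMem" using assms(5) by simp
  moreover have "s \<in> VV E X" using assms(1,5) VV_transitive funpow_star_closed by blast
  ultimately show ?thesis using assms(1-3) by (simp add: sat_PairMem funpow_star_closed)
qed

text \<open>This version serves the section of a set over one fixed left coordinate, which transfer
  moves as a parameter.\<close>

lemma transfer_pair_right:
  assumes "B \<in> VV E X" "c \<in> VV E X" "A \<in> VV E X"
    and "\<And>t. t \<in> ext E B \<Longrightarrow> pair E X c t \<in> ext E A"
    and "t \<in> ext E ((star ^^ k) B)"
  shows "pair E X ((star ^^ k) c) t \<in> ext E ((star ^^ k) A)"
proof -
  let ?e = "\<lambda>i::nat. if i = 0 then c else if i = 2 then A else B"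
  have "range ?e \<subseteq> VV E X" using assms by auto
  moreover have "sat E ?e (BAll 1 7 PairMem)"
    using assms VV_transitive by (simp add: sat_PairMem)
  ultimately have "sat E ((star ^^ k) \<circ> ?e) (BAll 1 7 PairMem)" using funpow_transfer by blast
  then have "sat E (((star ^^ k) \<circ> ?e)(1 := t)) PairMem" using assms(5) by simp
  moreover have "t \<in> VV E X" using assms(1,5) VV_transitive funpow_star_closed by blast
  ultimately show ?thesis using assms(1-3) by (simp add: sat_PairMem funpow_star_closed)
qed

lemma pair_mem_mu_tensor:
  assumes S: "S \<in> VV E X" "T \<in> VV E X"
    and coh: "completely_coherent E X star S"
    and V: "ext E T \<in> V"
    and \<alpha>: "\<alpha> \<in> mu E X star n U" and \<beta>: "\<beta> \<in> mu E X star m V"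
  shows "pair E X \<alpha> ((star ^^ n) \<beta>) \<in> mu E X star (n + m) (tensor E X S T U V)"
  unfolding mu_def
proof
  fix A assume A: "A \<in> tensor E X S T U V"
  define sec where "sec s = {t \<in> ext E T. pair E X s t \<in> A}" for s
  define B where "B = {s \<in> ext E S. sec s \<in> V}"
  have AC: "A \<subseteq> cart E X S T" and BU: "B \<in> U"
    using A by (auto simp: tensor_def B_def sec_def)
  let ?A = "code E X A"
  \<comment> \<open>\<open>code\<close> is meaningful only for subsets of a level, so
    \<open>A\<close>, \<open>B\<close> and the sections are each placed inside an element of
    V(X).\<close>
  have A': "?A \<in> VV E X" "ext E ?A = A"
    using code_subset[of "code E X (cart E X S T)" A] cart_VV[OF S] AC by auto
  have B': "code E X B \<in> VV E X" "ext E (code E X B) = B"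
    using code_subset[OF S(1), of B] by (auto simp: B_def)
  have sec': "code E X (sec s) \<in> VV E X" "ext E (code E X (sec s)) = sec s" for s
    using code_subset[OF S(2), of "sec s"] by (auto simp: sec_def)
  \<comment> \<open>The extension of \<open>T\<close> makes the family intersected in
    \<open>mu\<close> nonempty; this puts \<open>\<beta>\<close> into V(X), as a transfer parameter
    must be.\<close>
  have "\<beta> \<in> ext E ((star ^^ m) (code E X (ext E T)))" using \<beta> V by (auto simp: mu_def)
  moreover have "code E X (ext E T) \<in> VV E X" using code_subset(1)[OF S(2)] by blast
  ultimately have \<beta>VV: "\<beta> \<in> VV E X" using VV_transitive funpow_star_closed by blast
  have "pair E X s \<beta> \<in> ext E ((star ^^ m) ?A)" if "s \<in> ext E (code E X B)" for s
  proof -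
    have s: "s \<in> ext E S" "sec s \<in> V" using that B' by (auto simp: B_def)
    have "star s = s" using coherent_imp_fixed coh S(1) s(1) by blast
    \<comment> \<open>Transfer along the m-th iterate also moves the parameter \<open>s\<close>;
      this equation brings the left coordinate back.\<close>
    then have fixed: "(star ^^ m) s = s" by (induction m) simp_all
    have "s \<in> VV E X" using VV_transitive S(1) s(1) by blast
    moreover have "\<beta> \<in> ext E ((star ^^ m) (code E X (sec s)))"
      using \<beta> s(2) by (auto simp: mu_def)
    moreover have "pair E X s t \<in> ext E ?A" if "t \<in> ext E (code E X (sec s))" for t
      using that sec' A' by (auto simp: sec_def)
    ultimately have "pair E X ((star ^^ m) s) \<beta> \<in> ext E ((star ^^ m) ?A)"
      using transfer_pair_right sec'(1) A'(1) by blast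
    then show ?thesis by (simp add: fixed)
  qed
  moreover have "\<alpha> \<in> ext E ((star ^^ n) (code E X B))" using \<alpha> BU by (auto simp: mu_def)
  \<comment> \<open>Now \<open>\<beta>\<close> is the parameter and moves to its n-th star, while
    the quantified \<open>s\<close> is instantiated with \<open>\<alpha>\<close>.\<close>
  ultimately have "pair E X \<alpha> ((star ^^ n) \<beta>) \<in> ext E ((star ^^ n) ((star ^^ m) ?A))"
    using transfer_pair_left B'(1) \<beta>VV funpow_star_closed[OF A'(1)] by blast
  then show "pair E X \<alpha> ((star ^^ n) \<beta>) \<in> ext E ((star ^^ (n + m)) ?A)"
    by (simp add: funpow_add)
qed

end

theorem theorem4p13:
  fixes E :: "'v \<Rightarrow> 'v \<Rightarrow> bool" and X :: "'v set" and star :: "'v \<Rightarrow> 'v"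
    and n m :: nat and S1 S2 \<alpha> \<beta> :: 'v and U V :: "'v set set"
  assumes "single_superstructure_model E X star"
    and "S1 \<in> VV E X - X" and "S2 \<in> VV E X - X"
    and "completely_coherent E X star S1"
    and "ultrafilter_on (ext E S1) U" and "ultrafilter_on (ext E S2) V"
    and "\<alpha> \<in> mu E X star n U" and "\<beta> \<in> mu E X star m V"
  shows "pair E X \<alpha> ((star ^^ n) \<beta>) \<in> mu E X star (n + m) (tensor E X S1 S2 U V)"
proof -
  interpret single_superstructure_model E X star by (fact assms(1))
  have "ext E S2 \<in> V" using assms(6) by (simp add: ultrafilter_on_def)
  then show ?thesis using pair_mem_mu_tensor assms by blast
qed

end
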